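(* Let $G$ be either the De Bruijn digraph $B(d,D)$ or the Kautz digraph $K(d,D)$, with vertex set $V$, let $V=\mathcal{V}_1\cup\cdots\cup\mathcal{V}_l$ be the partition of $V$ into classes of the relation $\sim$, and let $1\le i\le D$. For any choice of the vertices $v^{(1)},\ldots, v^{(l)}$, where $v^{(r)}\in\mathcal{V}_r$, the input probability $\mathbb{P}_{\mathsf{in}}(i)$ is given by $$\mathbb{P}_{\mathsf{in}}(i)=\sum_{r=1}^l \frac{|S_{i}^\star(v^{(r)})|}{|V|-1}\cdot\frac{|\mathcal{V}_r|}{|V|},$$ and has the following rational expression: $$\mathbb{P}_{\mathsf{in}}(i)=\sum_{r=1}^l\frac{ |\mathcal{V}_r|}{|V|(|V|-1)}\left( d^i-a^{(r,i)}_{i-1}d^{i-1}-\cdots -a^{(r,i)}_{1} d-a^{(r,i)}_{0} \right),$$ where $a^{(r,i)}_{k}\in\{0,1\}$. More precisely, $a^{(r,i)}_{k}=1$ if and only if $S_{k,i}(v^{(r)})\neq\emptyset$; if and only if $v^{(r)}_{[k+1,D-(i-k)]}=v^{(r)}_{[i+1,D]}$ and $v^{(r)}_{[k+1,D-(j-k)]}\ne v^{(r)}_{[j+1,D]}$ for all $j$, $k<j< i$.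
   Context: Let $d\ge 2$ and $D\ge 1$ be integers. The De Bruijn digraph $B(d,D)$ has as vertices all words $v=v_1v_2\cdots v_D$ over an alphabet $A$ with $|A|=d$; $v$ is adjacent to the $d$ vertices $v_2\cdots v_D v_{D+1}$, $v_{D+1}\in A$ (loops occur). The Kautz digraph $K(d,D)$ has as vertices all words $v=v_1v_2\cdots v_D$ over an alphabet $A$ with $|A|=d+1$ such that $v_k\ne v_{k+1}$ for $1\le k<D$; $v$ is adjacent to the $d$ vertices $v_2\cdots v_Dv_{D+1}$ with $v_{D+1}\in A$, $v_{D+1}\ne v_D$. Both are $d$-regular of diameter $D$. For $v=v_1\cdots v_D$, $v_{[a,b]}$ denotes the subword $v_av_{a+1}\cdots v_b$ (the empty word if $b=a-1$; two empty words are equal). For $v\in V$ and $i\ge 0$, $S_i(v)$ is the set of vertices $u$ for which there is a walk of length exactly $i$ from $v$ to $u$, and $S_i^\star(v)$ is the set of vertices at (directed) distance exactly $i$ from $v$. For integers $0\le k\le i\le D$: $S_{k,i}(v)=S_k(v)$ if $S_k(v)\subseteq S_i(v)$ and, for all $j$ with $k<j<i$ such that $S_j(v)\subseteq S_i(v)$, we have $S_k(v)\not\subseteq S_j(v)$; otherwise $S_{k,i}(v)=\emptyset$. Equivalence relation on $V$: $v_1\cdots v_D\sim v'_1\cdots v'_D$ if and only if there is a permutation $\sigma$ of the alphabet $A$ with $\sigma(v_k)=v'_k$ for $1\le k\le D$. Its classes are denoted $\mathcal{V}_1,\dots,\mathcal{V}_l$. Input probability: for a vertex $v$ selected uniformly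 at random from $V$, and another, distinct, vertex $v'$ selected uniformly at random from $V\setminus\{v\}$, $\mathbb{P}_{\mathsf{in}}(i)$ is the probability that $v'$ is at distance $i$ from $v$.
   Formalization: For the Kautz digraph with i = D the subword criterion as stated is false (e.g. K(2,1), k = 0: two empty words agree but S_{0,1}(v) is empty); there its first condition is replaced by v_{k+1} ≠ v_D, the condition on all j being unchanged. *)

theory Defs
  imports
    "Graph_Theory.Shortest_Path"
    "HOL-Combinatorics.Permutations"
    "HOL-Probability.Probability_Mass_Function"
begin

type_synonym 'a word_digraph = "('a list, 'a list \<times> 'a list) pre_digraph"

definition de_bruijn :: "'a set \<Rightarrow> nat \<Rightarrow> 'a word_digraph" where
  "de_bruijn A D =
     (let V = {v. set v \<subseteq> A \<and> length v = D} in
      \<lparr> verts = V,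
        arcs = {(v, tl v @ [x]) | v x. v \<in> V \<and> x \<in> A},
        tail = fst, head = snd \<rparr>)"

definition kautz :: "'a set \<Rightarrow> nat \<Rightarrow> 'a word_digraph" where
  "kautz A D =
     (let V = {v. set v \<subseteq> A \<and> length v = D \<and> distinct_adj v} in
      \<lparr> verts = V,
        arcs = {(v, tl v @ [x]) | v x. v \<in> V \<and> x \<in> A \<and> x \<noteq> last v},
        tail = fst, head = snd \<rparr>)"

text \<open>Subwords use positions counted from 1, as in \<open>v\<^sub>1v\<^sub>2\<dots>v\<^sub>D\<close>:
  \<open>subword v a b\<close> is \<open>v\<^sub>a\<dots>v\<^sub>b\<close>, and it is empty for \<open>b = a - 1\<close>.

  Comparing \<open>v\<^sub>k\<^sub>+\<^sub>1\<dots>\<close> with \<open>v\<^sub>i\<^sub>+\<^sub>1\<dots>v\<^sub>D\<close> decides whether the words reached from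
  \<open>v\<close> in \<open>k\<close> steps are all reached in \<open>i\<close> steps, with one exception: in the Kautz
  digraph \<open>D\<close> steps reach exactly the words whose first letter is not \<open>v\<^sub>D\<close>, so for
  \<open>i = D\<close> both subwords are empty but the condition is \<open>v\<^sub>k\<^sub>+\<^sub>1 \<noteq> v\<^sub>D\<close>.\<close>

definition subword :: "'a list \<Rightarrow> nat \<Rightarrow> nat \<Rightarrow> 'a list" where
  "subword v a b = take (b + 1 - a) (drop (a - 1) v)"

definition walk_set :: "('v, 'e) pre_digraph \<Rightarrow> nat \<Rightarrow> 'v \<Rightarrow> 'v set" where
  "walk_set G i v = {u. \<exists>p. pre_digraph.awalk G v p u \<and> length p = i}"

text \<open>With all arc weights 1, \<open>\<mu>\<close> is the ordinary directed distance
  (infinite if there is no walk).\<close>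

definition dist_set :: "('v, 'e) pre_digraph \<Rightarrow> nat \<Rightarrow> 'v \<Rightarrow> 'v set" where
  "dist_set G i v = {u. wf_digraph.\<mu> G (\<lambda>_. 1) v u = ereal (real i)}"

definition max_walk_set :: "('v, 'e) pre_digraph \<Rightarrow> nat \<Rightarrow> nat \<Rightarrow> 'v \<Rightarrow> 'v set" where
  "max_walk_set G k i v =
     (if walk_set G k v \<subseteq> walk_set G i v \<and>
         (\<forall>j. k < j \<and> j < i \<and> walk_set G j v \<subseteq> walk_set G i v \<longrightarrow>
              \<not> walk_set G k v \<subseteq> walk_set G j v)
      then walk_set G k v else {})"

definition word_equiv :: "'a set \<Rightarrow> 'a word_digraph \<Rightarrow> ('a list \<times> 'a list) set" where
  "word_equiv A G =
     {(v, v'). v \<in> verts G \<and> v' \<in> verts G \<and> (\<exists>\<sigma>. \<sigma> permutes A \<and> map \<sigma> v = v')}"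

definition input_pmf :: "('v, 'e) pre_digraph \<Rightarrow> ('v \<times> 'v) pmf" where
  "input_pmf G =
     bind_pmf (pmf_of_set (verts G)) (\<lambda>v.
       map_pmf (\<lambda>v'. (v, v')) (pmf_of_set (verts G - {v})))"

definition P_in :: "('v, 'e) pre_digraph \<Rightarrow> nat \<Rightarrow> real" where
  "P_in G i = measure_pmf.prob (input_pmf G) {(v, v'). v' \<in> dist_set G i v}"

lemma tl_set: "x \<in> set (tl v) \<Longrightarrow> set v \<subseteq> A \<Longrightarrow> x \<in> A"
  by (cases v) auto

lemma wf_digraph_de_bruijn: "wf_digraph (de_bruijn A D)"
  if "D \<ge> 1"
  using that by unfold_locales (auto simp: de_bruijn_def Let_def intro: tl_set)

lemma wf_digraph_kautz: "wf_digraph (kautz A D)"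
  if "D \<ge> 1"
proof -
  have adj: "distinct_adj (tl v @ [x])" if "distinct_adj v" "x \<noteq> last v" for v :: "'a list" and x
    using that by (cases v) (auto simp: distinct_adj_append_iff distinct_adj_Cons split: if_splits)
  show ?thesis
    using that by unfold_locales (auto simp: kautz_def Let_def adj intro: tl_set)
qed

lemma equiv_word_equiv: "equiv (verts G) (word_equiv A G)"
proof (rule equivI)
  show "refl_on (verts G) (word_equiv A G)"
    by (auto simp: refl_on_def word_equiv_def intro!: exI[of _ id] permutes_id)
  show "word_equiv A G \<subseteq> verts G \<times> verts G"
    by (auto simp: word_equiv_def)
  show "sym (word_equiv A G)"
  proof (rule symI)
    fix v v' assume "(v, v') \<in> word_equiv A G"
    then obtain \<sigma> where *: "v \<in> verts G" "v' \<in> verts G" "\<sigma> permutes A" "map \<sigma> v = v'"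
      by (auto simp: word_equiv_def)
    have "map (inv \<sigma>) v' = v"
      using *(3,4) by (auto simp: permutes_inverses(2) map_idI)
    then show "(v', v) \<in> word_equiv A G"
      using * permutes_inv[OF *(3)] by (auto simp: word_equiv_def)
  qed
  show "trans (word_equiv A G)"
  proof (rule transI)
    fix u v w assume "(u, v) \<in> word_equiv A G" "(v, w) \<in> word_equiv A G"
    then obtain \<sigma> \<tau> where "u \<in> verts G" "w \<in> verts G" "\<sigma> permutes A" "\<tau> permutes A"
        "map (\<tau> \<circ> \<sigma>) u = w"
      by (auto simp: word_equiv_def)
    then show "(u, w) \<in> word_equiv A G"
      using permutes_compose[of \<sigma> A \<tau>] unfolding word_equiv_def by blast
  qed
qed

end

theory Submission
  imports Defs
begin

text \<open>
  Write \<open>S\<^sub>k\<close> for the set of vertices reached from \<open>v\<close> by walks of length \<open>k\<close>. For \<open>k \<le> D\<close> a walk of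
  length \<open>k\<close> keeps the last \<open>D - k\<close> letters of \<open>v\<close> as a prefix and appends \<open>k\<close> letters, each with \<open>d\<close>
  possible values; so \<open>S\<^sub>k\<close> has \<open>d\<^sup>k\<close> elements and is essentially the cylinder of all words
  beginning with \<open>v\<^sub>k\<^sub>+\<^sub>1\<dots>v\<^sub>D\<close>. Two cylinders are nested or disjoint, and which of the two
  happens is read off from the prefixes (\<open>walk_set_overlap_iff\<close>). The full length \<open>k = D\<close> is
  slightly different, since no letter of \<open>v\<close> survives; in the Kautz digraph \<open>S\<^sub>D\<close> is the set of words
  whose first letter is not \<open>v\<^sub>D\<close>. But membership there still depends on the first letter
  only, and all members of \<open>S\<^sub>k\<close> with \<open>k < D\<close> share theirs, so the dichotomy survives.

  The vertices at distance exactly \<open>i\<close> are those of \<open>S\<^sub>i\<close> in no earlier \<open>S\<^sub>k\<close>. By the dichotomy,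
  what has to be removed from \<open>S\<^sub>i\<close> is the union of the \<open>S\<^sub>k \<subseteq> S\<^sub>i\<close>, and it is the disjoint
  union of those that no \<open>S\<^sub>j\<close> with \<open>k < j < i\<close> contains (\<open>card_Diff_laminar\<close>). Counting
  gives \<open>d\<^sup>i\<close> minus the powers \<open>d\<^sup>k\<close> for these \<open>k\<close> (\<open>card_dist_set\<close>).

  Renaming letters is an automorphism of the digraph, so the number of vertices at distance \<open>i\<close> is
  the same throughout a class, and the average over all \<open>v\<close> that defines the input probability
  becomes a sum over class representatives weighted by class sizes
  (\<open>P_in_eq_sum_over_classes\<close>).

  Both digraphs are treated together: they consist of the words whose consecutive letters satisfy a
  relation \<open>R\<close> on the alphabet, namely the full relation (De Bruijn) or \<open>\<noteq>\<close> (Kautz). All that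
  matters about \<open>R\<close> is that every letter has \<open>d\<close> successors and that permutations of the
  alphabet preserve it.
\<close>

section \<open>Distances and walk lengths\<close>

text \<open>With unit weights the infimum ranges over natural numbers, so a shortest walk attains it.\<close>

lemma (in wf_digraph) mu_eq_iff_shortest_walk_length:
  "\<mu> (\<lambda>_. 1) u v = ereal (real i) \<longleftrightarrow>
     (\<exists>p. awalk u p v \<and> length p = i) \<and> (\<forall>p. awalk u p v \<longrightarrow> i \<le> length p)"
proof (cases "\<exists>p. awalk u p v")
  case False
  then show ?thesis
    by (auto simp: \<mu>_def top_ereal_def)
next
  case True
  have cost: "awalk_cost (\<lambda>_. 1) p = real (length p)" for p
    by (induction p) auto
  obtain q where q: "awalk u q v" "\<And>p. awalk u p v \<Longrightarrow> length q \<le> length p"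
    using True ex_has_least_nat[of "\<lambda>p. awalk u p v" _ length] by auto
  have "\<mu> (\<lambda>_. 1) u v = ereal (real (length q))"
    unfolding \<mu>_def cost using q
    by (intro antisym INF_greatest INF_lower2[of q]) auto
  then show ?thesis
    using q by (auto intro: antisym)
qed

lemma dist_set_eq_walk_set_Diff:
  assumes "wf_digraph G"
  shows "dist_set G i v = walk_set G i v - (\<Union>j<i. walk_set G j v)"
proof -
  have "(\<forall>p. pre_digraph.awalk G v p u \<longrightarrow> i \<le> length p) \<longleftrightarrow> (\<forall>j<i. u \<notin> walk_set G j v)" for u
    unfolding walk_set_def mem_Collect_eq by (metis not_le)
  then show ?thesis
    unfolding dist_set_def wf_digraph.mu_eq_iff_shortest_walk_length[OF assms]
    by (auto simp: walk_set_def)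
qed

lemma walk_set_0:
  assumes "v \<in> verts G"
  shows "walk_set G 0 v = {v}"
  using assms by (auto simp: walk_set_def pre_digraph.awalk_def pre_digraph.cas.simps)

lemma (in wf_digraph) walk_set_Suc:
  "walk_set G (Suc i) v = (\<Union>u\<in>walk_set G i v. head G ` {e \<in> arcs G. tail G e = u})"
proof (intro equalityI subsetI)
  fix w assume "w \<in> walk_set G (Suc i) v"
  then obtain p where p: "awalk v p w" "length p = Suc i"
    by (auto simp: walk_set_def)
  then obtain q e where "p = q @ [e]" "length q = i"
    by (metis length_Suc_conv_rev)
  with p have "awalk v q (awlast v q)" "e \<in> arcs G" "tail G e = awlast v q" "w = head G e"
    by (auto simp: awalk_Cons_iff awalk_Nil_iff)
  with \<open>length q = i\<close> show "w \<in> (\<Union>u\<in>walk_set G i v. head G ` {e \<in> arcs G. tail G e = u})"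
    by (auto simp: walk_set_def)
next
  fix w assume "w \<in> (\<Union>u\<in>walk_set G i v. head G ` {e \<in> arcs G. tail G e = u})"
  then obtain q e where "awalk v q (tail G e)" "length q = i" "e \<in> arcs G" "w = head G e"
    by (auto simp: walk_set_def)
  then have "awalk v (q @ [e]) w" "length (q @ [e]) = Suc i"
    using arc_implies_awalk awalk_appendI by auto
  then show "w \<in> walk_set G (Suc i) v"
    unfolding walk_set_def by blast
qed

section \<open>Counting in a laminar family\<close>

text \<open>
  Unlike in the definition of \<open>max_walk_set\<close>, an intermediate \<open>S j\<close> need not lie in \<open>S i\<close>. For
  nonempty sets that are nested or disjoint the two versions agree, because an \<open>S j\<close>
  containing \<open>S k \<subseteq> S i\<close> meets \<open>S i\<close>.
\<close>

definition maximal_indices :: "(nat \<Rightarrow> 'b set) \<Rightarrow> nat \<Rightarrow> nat set" where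
  "maximal_indices S i = {k. k < i \<and> S k \<subseteq> S i \<and> (\<forall>j. k < j \<and> j < i \<longrightarrow> \<not> S k \<subseteq> S j)}"

text \<open>
  Every point of \<open>S i\<close> that lies in an earlier set lies in a last one, say \<open>S m\<close> with \<open>m < i\<close>, and
  then \<open>m\<close> is maximal. Two different maximal sets cannot meet, as they would be nested. So the
  maximal sets partition what is removed from \<open>S i\<close>.
\<close>

lemma card_Diff_laminar:
  fixes S :: "nat \<Rightarrow> 'b set"
  assumes fin: "\<And>k. k \<le> i \<Longrightarrow> finite (S k)"
    and laminar: "\<And>k j. k < j \<Longrightarrow> j \<le> i \<Longrightarrow> S k \<inter> S j \<noteq> {} \<Longrightarrow> S k \<subseteq> S j"
  shows "card (S i - (\<Union>j<i. S j)) + (\<Sum>k\<in>maximal_indices S i. card (S k)) = card (S i)"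
proof -
  let ?M = "maximal_indices S i"
  have finM: "finite ?M"
    by (rule finite_subset[of _ "{..<i}"]) (auto simp: maximal_indices_def)
  have "S i \<inter> (\<Union>j<i. S j) \<subseteq> (\<Union>k\<in>?M. S k)"
  proof
    fix x assume "x \<in> S i \<inter> (\<Union>j<i. S j)"
    then obtain j where j: "j < i" "x \<in> S j" "x \<in> S i" by auto
    \<comment> \<open>No later set below \<open>i\<close> contains \<open>x\<close>, hence none contains \<open>S m\<close>.\<close>
    define m where "m = Max {k. k < i \<and> x \<in> S k}"
    have "m \<in> {k. k < i \<and> x \<in> S k}"
      unfolding m_def by (rule Max_in) (use j in auto)
    then have m: "m < i" "x \<in> S m" by auto
    have "\<not> S m \<subseteq> S k" if "m < k" "k < i" for k
    proof
      assume "S m \<subseteq> S k"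
      then have "x \<in> S k" using m by blast
      then have "k \<le> m" unfolding m_def using that by (intro Max_ge) auto
      with that show False by simp
    qed
    moreover have "S m \<subseteq> S i"
      using laminar[of m i] m j by auto
    ultimately have "m \<in> ?M"
      using m by (auto simp: maximal_indices_def)
    with m show "x \<in> (\<Union>k\<in>?M. S k)" by blast
  qed
  then have Un: "S i \<inter> (\<Union>j<i. S j) = (\<Union>k\<in>?M. S k)"
    by (auto simp: maximal_indices_def)
  have disj: "S k \<inter> S j = {}" if "k \<in> ?M" "j \<in> ?M" "k < j" for k j
    using laminar[of k j] that by (auto simp: maximal_indices_def)
  have "card (\<Union>k\<in>?M. S k) = (\<Sum>k\<in>?M. card (S k))"
  proof (rule card_UN_disjoint[OF finM])
    show "\<forall>k\<in>?M. finite (S k)"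
      using fin by (auto simp: maximal_indices_def)
    show "\<forall>k\<in>?M. \<forall>j\<in>?M. k \<noteq> j \<longrightarrow> S k \<inter> S j = {}"
    proof (intro ballI impI)
      fix k j assume "k \<in> ?M" "j \<in> ?M" "k \<noteq> j"
      then show "S k \<inter> S j = {}"
        using disj[of k j] disj[of j k] by (cases "k < j") (simp_all add: Int_commute)
    qed
  qed
  moreover have "card (S i - (\<Union>j<i. S j)) + card (S i \<inter> (\<Union>j<i. S j)) = card (S i)"
    using card_Int_Diff[OF fin[of i], of "\<Union>j<i. S j"] by simp
  ultimately show ?thesis
    unfolding Un by simp
qed

lemma max_walk_set_nonempty_iff:
  assumes "k < i" "walk_set G k v \<noteq> {}"
    and laminar: "\<And>k j. k < j \<Longrightarrow> j \<le> i \<Longrightarrow> walk_set G k v \<inter> walk_set G j v \<noteq> {} \<Longrightarrow>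
                    walk_set G k v \<subseteq> walk_set G j v"
  shows "max_walk_set G k i v \<noteq> {} \<longleftrightarrow> k \<in> maximal_indices (\<lambda>j. walk_set G j v) i"
proof -
  have "walk_set G j v \<subseteq> walk_set G i v"
    if "j < i" "walk_set G k v \<subseteq> walk_set G j v" "walk_set G k v \<subseteq> walk_set G i v" for j
    using laminar[of j i] that assms(2) by blast
  then have "walk_set G k v \<subseteq> walk_set G i v \<Longrightarrow>
      (\<forall>j. k < j \<and> j < i \<and> walk_set G j v \<subseteq> walk_set G i v \<longrightarrow> \<not> walk_set G k v \<subseteq> walk_set G j v)
        \<longleftrightarrow> (\<forall>j. k < j \<and> j < i \<longrightarrow> \<not> walk_set G k v \<subseteq> walk_set G j v)"
    by blast
  moreover have "max_walk_set G k i v \<noteq> {} \<longleftrightarrow> walk_set G k v \<subseteq> walk_set G i v \<and>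
      (\<forall>j. k < j \<and> j < i \<and> walk_set G j v \<subseteq> walk_set G i v \<longrightarrow> \<not> walk_set G k v \<subseteq> walk_set G j v)"
    using assms(2) by (simp add: max_walk_set_def)
  ultimately show ?thesis
    unfolding maximal_indices_def mem_Collect_eq using assms(1) by (simp only: simp_thms cong: conj_cong)
qed

section \<open>Averaging over vertices and over classes\<close>

text \<open>
  Sampling from an empty set is meaningless, which is why there must be a vertex, and
  a second one next to each vertex.
\<close>

lemma P_in_eq_sum:
  assumes fin: "finite (verts G)" and ne: "verts G \<noteq> {}"
    and other: "\<And>v. v \<in> verts G \<Longrightarrow> verts G - {v} \<noteq> {}"
    and sub: "\<And>v. v \<in> verts G \<Longrightarrow> dist_set G i v \<subseteq> verts G - {v}"
  shows "P_in G i = (\<Sum>v\<in>verts G. real (card (dist_set G i v)) / (real (card (verts G)) - 1))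
                      / real (card (verts G))"
proof -
  let ?V = "verts G"
  have inner: "measure_pmf.prob (map_pmf (Pair v) (pmf_of_set (?V - {v}))) {(v, v'). v' \<in> dist_set G i v}
                = real (card (dist_set G i v)) / (real (card ?V) - 1)"
    if v: "v \<in> ?V" for v
  proof -
    have "Pair v -` {(v, v'). v' \<in> dist_set G i v} = dist_set G i v"
      by auto
    moreover have "(?V - {v}) \<inter> dist_set G i v = dist_set G i v"
      using sub[OF v] by auto
    moreover have "real (card (?V - {v})) = real (card ?V) - 1"
      using card_Suc_Diff1[OF fin v] by linarith
    ultimately show ?thesis
      using fin other[OF v] by (simp add: measure_pmf_of_set)
  qed
  have "P_in G i = measure_pmf.expectation (pmf_of_set ?V)
          (\<lambda>v. measure_pmf.prob (map_pmf (Pair v) (pmf_of_set (?V - {v}))) {(v, v'). v' \<in> dist_set G i v})"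
    unfolding P_in_def input_pmf_def measure_pmf_bind
    by (rule measure_pmf.measure_bind[where N = "count_space UNIV"]) (auto simp: measure_pmf_in_subprob_space)
  also have "\<dots> = (\<Sum>v\<in>?V. real (card (dist_set G i v)) / (real (card ?V) - 1)) / real (card ?V)"
    using fin ne by (simp add: integral_pmf_of_set inner del: measure_map_pmf)
  finally show ?thesis .
qed

lemma sum_over_quotient:
  fixes f :: "'b \<Rightarrow> real"
  assumes fin: "finite V" and eqv: "equiv V r"
    and bij: "bij_betw cls I (V // r)"
    and rep: "\<And>s. s \<in> I \<Longrightarrow> v s \<in> cls s"
    and inv: "\<And>x y. (x, y) \<in> r \<Longrightarrow> f x = f y"
  shows "(\<Sum>x\<in>V. f x) = (\<Sum>s\<in>I. real (card (cls s)) * f (v s))"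
proof -
  have "(\<Sum>x\<in>V. f x) = (\<Sum>x\<in>\<Union>(V // r). f x)"
    using Union_quotient[OF eqv] by simp
  also have "\<dots> = (\<Sum>C\<in>V // r. \<Sum>x\<in>C. f x)"
    using finite_equiv_class[OF fin equiv_type[OF eqv]] quotient_disj[OF eqv]
    by (subst sum.Union_disjoint) (simp_all, blast)
  also have "\<dots> = (\<Sum>s\<in>I. \<Sum>x\<in>cls s. f x)"
    using sum.reindex_bij_betw[OF bij, of "\<lambda>C. \<Sum>x\<in>C. f x"] by simp
  also have "\<dots> = (\<Sum>s\<in>I. real (card (cls s)) * f (v s))"
  proof (rule sum.cong[OF refl])
    fix s assume s: "s \<in> I"
    then have "cls s \<in> V // r" using bij by (auto simp: bij_betw_def)
    then have "f x = f (v s)" if "x \<in> cls s" for x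
      using quotient_eq_iff[OF eqv _ _ that rep[OF s]] by (intro inv) simp
    then show "(\<Sum>x\<in>cls s. f x) = real (card (cls s)) * f (v s)" by simp
  qed
  finally show ?thesis .
qed


section \<open>Word digraphs over a regular letter relation\<close>

definition shift_digraph :: "('a \<Rightarrow> 'a \<Rightarrow> bool) \<Rightarrow> 'a set \<Rightarrow> nat \<Rightarrow> 'a word_digraph" where
  "shift_digraph R A D =
     (let V = {v. set v \<subseteq> A \<and> length v = D \<and> successively R v} in
      \<lparr> verts = V,
        arcs = {(v, tl v @ [x]) | v x. v \<in> V \<and> x \<in> A \<and> R (last v) x},
        tail = fst, head = snd \<rparr>)"

lemma de_bruijn_eq_shift_digraph: "de_bruijn A D = shift_digraph (\<lambda>_ _. True) A D"
proof -
  have "successively (\<lambda>_ _. True) v" for v :: "'a list"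
    by (simp add: successively_conv_nth)
  then show ?thesis by (simp add: de_bruijn_def shift_digraph_def)
qed

lemma kautz_eq_shift_digraph: "kautz A D = shift_digraph (\<noteq>) A D"
  by (auto simp: kautz_def shift_digraph_def distinct_adj_def Let_def)

text \<open>The letters appended along the walks of length \<open>i\<close> from \<open>v\<close>.\<close>

definition continuations :: "('a \<Rightarrow> 'a \<Rightarrow> bool) \<Rightarrow> 'a set \<Rightarrow> 'a list \<Rightarrow> nat \<Rightarrow> 'a list set" where
  "continuations R A v i = {w. length w = i \<and> set w \<subseteq> A \<and> successively R (v @ w)}"

locale regular_letter_relation =
  fixes R :: "'a \<Rightarrow> 'a \<Rightarrow> bool" and A :: "'a set" and d D :: nat
  assumes finite_alphabet: "finite A" and alphabet_nonempty: "A \<noteq> {}"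
    and out_degree: "\<And>x. x \<in> A \<Longrightarrow> card {y \<in> A. R x y} = d"
    and degree_ge_2: "d \<ge> 2" and length_pos: "D \<ge> 1"
    and relation_invariant: "\<And>\<sigma> x y. \<sigma> permutes A \<Longrightarrow> R (\<sigma> x) (\<sigma> y) = R x y"
begin

abbreviation G where "G \<equiv> shift_digraph R A D"

lemma in_verts_iff: "v \<in> verts G \<longleftrightarrow> set v \<subseteq> A \<and> length v = D \<and> successively R v"
  by (simp add: shift_digraph_def)

lemma verts_not_Nil: "v \<in> verts G \<Longrightarrow> v \<noteq> []"
  using length_pos by (auto simp: in_verts_iff)

lemma finite_verts: "finite (verts G)"
proof -
  have "verts G \<subseteq> {v. set v \<subseteq> A \<and> length v = D}" by (auto simp: in_verts_iff)
  then show ?thesis using finite_lists_length_eq[OF finite_alphabet] by (rule finite_subset)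
qed

lemma shift_in_verts:
  assumes "v \<in> verts G" "x \<in> A" "R (last v) x"
  shows "tl v @ [x] \<in> verts G"
proof -
  obtain y w where "v = y # w" using verts_not_Nil[OF assms(1)] by (cases v) auto
  then show ?thesis
    using assms by (cases "w = []") (auto simp: in_verts_iff successively_append_iff successively_Cons)
qed

lemma tail_eq [simp]: "tail G = fst" and head_eq [simp]: "head G = snd"
  by (simp_all add: shift_digraph_def Let_def)

lemma arcs_eq: "arcs G = {(v, tl v @ [x]) | v x. v \<in> verts G \<and> x \<in> A \<and> R (last v) x}"
  by (simp add: shift_digraph_def Let_def)

lemma wf_digraph_shift: "wf_digraph G"
  using shift_in_verts by unfold_locales (auto simp: arcs_eq)

lemma heads_of_arcs:
  assumes "u \<in> verts G"
  shows "head G ` {e \<in> arcs G. tail G e = u} = (\<lambda>x. tl u @ [x]) ` {x \<in> A. R (last u) x}"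
proof -
  have "{e \<in> arcs G. tail G e = u} = (\<lambda>x. (u, tl u @ [x])) ` {x \<in> A. R (last u) x}"
    unfolding arcs_eq tail_eq using assms by auto
  then show ?thesis
    by (simp add: image_image)
qed

lemma continuations_Suc:
  assumes "v \<noteq> []"
  shows "continuations R A v (Suc i) =
    (\<lambda>(w, x). w @ [x]) ` (SIGMA w:continuations R A v i. {x \<in> A. R (last (v @ w)) x})"
proof (intro equalityI subsetI)
  fix u assume u: "u \<in> continuations R A v (Suc i)"
  then obtain w x where wx: "u = w @ [x]" "length w = i"
    by (auto simp: continuations_def length_Suc_conv_rev)
  then have "successively R ((v @ w) @ [x])" "set (w @ [x]) \<subseteq> A"
    using u by (simp_all add: continuations_def)
  then have "w \<in> continuations R A v i" "x \<in> A" "R (last (v @ w)) x"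
    using assms wx by (auto simp: continuations_def successively_append_iff[of R "v @ w"] simp del: append_assoc)
  then show "u \<in> (\<lambda>(w, x). w @ [x]) ` (SIGMA w:continuations R A v i. {x \<in> A. R (last (v @ w)) x})"
    using wx by force
next
  fix u assume "u \<in> (\<lambda>(w, x). w @ [x]) ` (SIGMA w:continuations R A v i. {x \<in> A. R (last (v @ w)) x})"
  then obtain w x where "u = w @ [x]" "w \<in> continuations R A v i" "x \<in> A" "R (last (v @ w)) x"
    by auto
  then show "u \<in> continuations R A v (Suc i)"
    using assms successively_append_iff[of R "v @ w" "[x]"] by (auto simp: continuations_def)
qed

lemma card_continuations:
  assumes "v \<noteq> []" "set v \<subseteq> A" "successively R v"
  shows "card (continuations R A v i) = d ^ i"
proof (induction i)
  case 0
  have "continuations R A v 0 = {[]}"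
    using assms by (auto simp: continuations_def)
  then show ?case by simp
next
  case (Suc i)
  have "last (v @ w) \<in> A" if "w \<in> continuations R A v i" for w
    using that assms last_in_set[of "v @ w"] by (auto simp: continuations_def simp del: last_append last_in_set)
  then have *: "card {x \<in> A. R (last (v @ w)) x} = d" if "w \<in> continuations R A v i" for w
    using that out_degree by blast
  have fin: "finite (continuations R A v i)"
    using Suc degree_ge_2 by (intro card_ge_0_finite) simp
  have "card (continuations R A v (Suc i)) =
      card (SIGMA w:continuations R A v i. {x \<in> A. R (last (v @ w)) x})"
    unfolding continuations_Suc[OF assms(1)] by (rule card_image) (auto simp: inj_on_def)
  also have "\<dots> = (\<Sum>w\<in>continuations R A v i. card {x \<in> A. R (last (v @ w)) x})"
    using fin finite_alphabet by (intro card_SigmaI) auto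
  also have "\<dots> = d ^ Suc i"
    using * Suc by simp
  finally show ?case .
qed

lemma verts_nonempty: "verts G \<noteq> {}"
proof -
  obtain x where x: "x \<in> A" using alphabet_nonempty by blast
  have "card (continuations R A [x] (D - 1)) > 0"
    using card_continuations[of "[x]" "D - 1"] x degree_ge_2 by simp
  then obtain w where "w \<in> continuations R A [x] (D - 1)"
    by (auto simp: card_gt_0_iff)
  then have "x # w \<in> verts G"
    using x length_pos by (auto simp: continuations_def in_verts_iff)
  then show ?thesis by blast
qed

section \<open>Walk sets as cylinders\<close>

lemma walk_set_eq_continuations:
  assumes "v \<in> verts G"
  shows "walk_set G i v = (\<lambda>w. drop i (v @ w)) ` continuations R A v i"
proof (induction i)
  case 0
  have "continuations R A v 0 = {[]}"
    using assms by (auto simp: continuations_def in_verts_iff)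
  then show ?case using walk_set_0[OF assms] by simp
next
  case (Suc i)
  have succ: "head G ` {e \<in> arcs G. tail G e = drop i (v @ w)} =
      (\<lambda>x. drop (Suc i) (v @ w @ [x])) ` {x \<in> A. R (last (v @ w)) x}"
    if w: "w \<in> continuations R A v i" for w
  proof -
    have len: "i < length (v @ w)"
      using w assms length_pos by (auto simp: continuations_def in_verts_iff)
    have "successively R (take i (v @ w) @ drop i (v @ w))"
      using w unfolding append_take_drop_id by (simp add: continuations_def)
    then have "successively R (drop i (v @ w))"
      by (simp only: successively_append_iff)
    moreover have "set (drop i (v @ w)) \<subseteq> A"
      using w assms set_drop_subset[of i "v @ w"] by (auto simp: continuations_def in_verts_iff simp del: drop_append)
    ultimately have verts: "drop i (v @ w) \<in> verts G"
      using w assms by (auto simp: continuations_def in_verts_iff)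
    have last: "last (drop i (v @ w)) = last (v @ w)"
      using len by (simp only: last_drop)
    have tl: "tl (drop i (v @ w)) @ [x] = drop (Suc i) (v @ w @ [x])" for x
    proof -
      have "drop (Suc i) ((v @ w) @ [x]) = drop (Suc i) (v @ w) @ [x]"
        using len by (subst drop_append) simp
      then show ?thesis
        unfolding append_assoc by (simp only: drop_Suc tl_drop)
    qed
    show ?thesis
      unfolding heads_of_arcs[OF verts] last tl by (rule refl)
  qed
  have "walk_set G (Suc i) v =
      (\<Union>w\<in>continuations R A v i. (\<lambda>x. drop (Suc i) (v @ w @ [x])) ` {x \<in> A. R (last (v @ w)) x})"
    unfolding wf_digraph.walk_set_Suc[OF wf_digraph_shift] Suc using succ by simp
  also have "\<dots> = (\<lambda>w. drop (Suc i) (v @ w)) ` continuations R A v (Suc i)"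
    unfolding continuations_Suc[OF verts_not_Nil[OF assms]]
    by (simp add: Sigma_def image_UN image_image del: drop_append) blast
  finally show ?case .
qed

text \<open>For \<open>i \<le> D\<close> all the appended letters are still visible in the end vertex, so different walks
  of length \<open>i\<close> end in different vertices.\<close>

lemma card_walk_set:
  assumes "v \<in> verts G" "i \<le> D"
  shows "card (walk_set G i v) = d ^ i"
proof -
  have "length v = D" using assms by (simp add: in_verts_iff)
  then have "inj_on (\<lambda>w. drop i (v @ w)) (continuations R A v i)"
    using assms(2) by (intro inj_onI) simp
  then show ?thesis
    using assms verts_not_Nil[OF assms(1)]
    by (simp add: walk_set_eq_continuations card_image card_continuations in_verts_iff)
qed

text \<open>For \<open>i < D\<close> the last letter of \<open>v\<close> is part of the common prefix, and the transition to the
  first appended letter is checked inside \<open>u\<close>. For \<open>i = D\<close> the prefix is empty, so this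
  transition becomes a condition of its own.\<close>

lemma in_walk_set_iff:
  assumes v: "v \<in> verts G" and i: "i \<le> D"
  shows "u \<in> walk_set G i v \<longleftrightarrow>
    u \<in> verts G \<and> take (D - i) u = drop i v \<and> (i = D \<longrightarrow> R (last v) (hd u))"
proof
  assume "u \<in> walk_set G i v"
  then obtain w where w: "length w = i" "set w \<subseteq> A" "successively R (v @ w)" "u = drop i v @ w"
    using v i by (auto simp: walk_set_eq_continuations continuations_def in_verts_iff)
  have "successively R (take i v @ drop i v @ w)"
    using w by (simp only: append_assoc[symmetric] append_take_drop_id)
  then have "successively R u"
    using w by (simp add: successively_append_iff)
  moreover have "set u \<subseteq> A"
    using w v set_drop_subset[of i v] by (auto simp: in_verts_iff)
  moreover have "R (last v) (hd u)" if "i = D"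
    using w v that length_pos by (auto simp: in_verts_iff successively_append_iff)
  ultimately show "u \<in> verts G \<and> take (D - i) u = drop i v \<and> (i = D \<longrightarrow> R (last v) (hd u))"
    using w v i by (simp add: in_verts_iff)
next
  assume u: "u \<in> verts G \<and> take (D - i) u = drop i v \<and> (i = D \<longrightarrow> R (last v) (hd u))"
  then obtain w where uw: "u = drop i v @ w"
    by (metis append_take_drop_id)
  have lengths: "length u = D" "length v = D" "length w = i"
    using u v i uw by (auto simp: in_verts_iff)
  have succ: "successively R (drop i v @ w)" "set w \<subseteq> A"
    using u uw by (auto simp: in_verts_iff)
  have "i = 0 \<or> R (last v) (hd w)"
  proof (cases "i = D")
    case True
    with u uw lengths show ?thesis by simp
  next
    case False
    then have "drop i v \<noteq> []" "last (drop i v) = last v"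
      using lengths i by auto
    then show ?thesis using succ(1) lengths(3) by (auto simp: successively_append_iff)
  qed
  then have "w \<in> continuations R A v i"
    using v succ lengths(3)
    by (auto simp: continuations_def in_verts_iff successively_append_iff)
  then show "u \<in> walk_set G i v"
    unfolding walk_set_eq_continuations[OF v] using uw lengths i by auto
qed

lemma walk_set_nonempty:
  assumes "v \<in> verts G" "i \<le> D"
  shows "walk_set G i v \<noteq> {}"
  using card_walk_set[OF assms] degree_ge_2 by auto

lemma finite_walk_set:
  assumes "v \<in> verts G" "i \<le> D"
  shows "finite (walk_set G i v)"
  using card_walk_set[OF assms] degree_ge_2 by (intro card_ge_0_finite) simp

text \<open>The criterion on the right does not mention \<open>u\<close>: membership in the larger set depends only on
  letters that all members of \<open>walk_set G k v\<close> have in common. So \<open>walk_set G k v\<close> lies in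
  \<open>walk_set G i v\<close> entirely or not at all.\<close>

lemma walk_set_overlap_iff:
  assumes v: "v \<in> verts G" and ki: "k < i" "i \<le> D" and u: "u \<in> walk_set G k v"
  shows "u \<in> walk_set G i v \<longleftrightarrow>
    take (D - i) (drop k v) = drop i v \<and> (i = D \<longrightarrow> R (last v) (v ! k))"
proof -
  have 1: "u \<in> verts G" "take (D - k) u = drop k v"
    using u ki in_walk_set_iff[OF v, of k] by auto
  have "take (D - i) u = take (D - i) (take (D - k) u)"
    using ki by (simp add: min_def)
  then have 2: "take (D - i) u = take (D - i) (drop k v)"
    unfolding 1(2) .
  have "hd u = hd (take (D - k) u)"
    using ki by simp
  also have "\<dots> = v ! k"
    unfolding 1(2) using ki v by (simp add: hd_drop_conv_nth in_verts_iff)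
  finally have 3: "hd u = v ! k" .
  show ?thesis
    unfolding in_walk_set_iff[OF v ki(2)] 2 3 using 1(1) by blast
qed

lemma walk_set_subset_iff:
  assumes "v \<in> verts G" "k < i" "i \<le> D"
  shows "walk_set G k v \<subseteq> walk_set G i v \<longleftrightarrow>
    take (D - i) (drop k v) = drop i v \<and> (i = D \<longrightarrow> R (last v) (v ! k))"
proof -
  obtain u where "u \<in> walk_set G k v"
    using walk_set_nonempty[OF assms(1), of k] assms(2,3) by auto
  then show ?thesis
    using walk_set_overlap_iff[OF assms] by blast
qed

lemma walk_set_laminar:
  assumes "v \<in> verts G" "k < i" "i \<le> D" "walk_set G k v \<inter> walk_set G i v \<noteq> {}"
  shows "walk_set G k v \<subseteq> walk_set G i v"
  using walk_set_overlap_iff[OF assms(1-3)] assms(4) by blast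

lemma max_walk_set_nonempty_iff_subset:
  assumes "v \<in> verts G" "k < i" "i \<le> D"
  shows "max_walk_set G k i v \<noteq> {} \<longleftrightarrow> walk_set G k v \<subseteq> walk_set G i v \<and>
    (\<forall>j. k < j \<and> j < i \<longrightarrow> \<not> walk_set G k v \<subseteq> walk_set G j v)"
proof -
  have "max_walk_set G k i v \<noteq> {} \<longleftrightarrow> k \<in> maximal_indices (\<lambda>j. walk_set G j v) i"
    using assms by (intro max_walk_set_nonempty_iff walk_set_nonempty walk_set_laminar) auto
  then show ?thesis
    unfolding maximal_indices_def mem_Collect_eq using assms(2) by blast
qed

lemma card_dist_set:
  assumes v: "v \<in> verts G" and i: "i \<le> D"
  shows "real (card (dist_set G i v)) =
    real d ^ i - (\<Sum>k<i. of_bool (max_walk_set G k i v \<noteq> {}) * real d ^ k)"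
proof -
  let ?S = "\<lambda>j. walk_set G j v"
  have M: "maximal_indices ?S i = {k \<in> {..<i}. max_walk_set G k i v \<noteq> {}}"
    unfolding maximal_indices_def using max_walk_set_nonempty_iff_subset[OF v _ i] by blast
  have "card (?S i - (\<Union>j<i. ?S j)) + (\<Sum>k\<in>maximal_indices ?S i. card (?S k)) = card (?S i)"
    using i by (intro card_Diff_laminar finite_walk_set[OF v] walk_set_laminar[OF v]) auto
  also have "card (?S i) = d ^ i"
    by (rule card_walk_set[OF v i])
  also have "(\<Sum>k\<in>maximal_indices ?S i. card (?S k)) = (\<Sum>k\<in>maximal_indices ?S i. d ^ k)"
    using i by (intro sum.cong refl card_walk_set[OF v]) (auto simp: M)
  finally have "card (dist_set G i v) + (\<Sum>k\<in>maximal_indices ?S i. d ^ k) = d ^ i"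
    unfolding dist_set_eq_walk_set_Diff[OF wf_digraph_shift] .
  then have "real (card (dist_set G i v) + (\<Sum>k\<in>maximal_indices ?S i. d ^ k)) = real (d ^ i)"
    by (rule arg_cong)
  then have "real (card (dist_set G i v)) + (\<Sum>k\<in>maximal_indices ?S i. real d ^ k) = real d ^ i"
    by simp
  moreover have "(\<Sum>k\<in>maximal_indices ?S i. real d ^ k) =
      (\<Sum>k<i. of_bool (max_walk_set G k i v \<noteq> {}) * real d ^ k)"
    unfolding M by (intro sum.mono_neutral_cong_left) auto
  ultimately show ?thesis by simp
qed

section \<open>Renaming letters\<close>

lemma map_permutation_in_verts:
  assumes "\<sigma> permutes A" "v \<in> verts G"
  shows "map \<sigma> v \<in> verts G"
  using assms permutes_in_image[OF assms(1)]
  by (auto simp: in_verts_iff successively_map relation_invariant[OF assms(1)])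

text \<open>Renaming the letters of a walk gives a walk of the same length; this is one inclusion. Both
  sides have \<open>d\<^sup>i\<close> elements, so they are equal.\<close>

lemma walk_set_map_permutation:
  assumes \<sigma>: "\<sigma> permutes A" and v: "v \<in> verts G" and i: "i \<le> D"
  shows "walk_set G i (map \<sigma> v) = map \<sigma> ` walk_set G i v"
proof -
  note \<sigma>v = map_permutation_in_verts[OF \<sigma> v]
  have "map \<sigma> ` walk_set G i v \<subseteq> walk_set G i (map \<sigma> v)"
  proof
    fix u' assume "u' \<in> map \<sigma> ` walk_set G i v"
    then obtain w where w: "w \<in> continuations R A v i" "u' = map \<sigma> (drop i (v @ w))"
      unfolding walk_set_eq_continuations[OF v] by blast
    have "successively R (map \<sigma> (v @ w))"
      using w(1) unfolding successively_map relation_invariant[OF \<sigma>] by (simp add: continuations_def)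
    then have "map \<sigma> w \<in> continuations R A (map \<sigma> v) i"
      using w(1) permutes_in_image[OF \<sigma>] by (auto simp: continuations_def)
    moreover have "u' = drop i (map \<sigma> v @ map \<sigma> w)"
      unfolding w(2) map_append[symmetric] drop_map ..
    ultimately show "u' \<in> walk_set G i (map \<sigma> v)"
      unfolding walk_set_eq_continuations[OF \<sigma>v] by blast
  qed
  moreover have "card (map \<sigma> ` walk_set G i v) = card (walk_set G i (map \<sigma> v))"
    using card_walk_set[OF v i] card_walk_set[OF \<sigma>v i] permutes_inj[OF \<sigma>]
    by (simp add: card_image inj_on_def)
  ultimately show ?thesis
    using card_subset_eq[OF finite_walk_set[OF \<sigma>v i]] by blast
qed

lemma card_dist_set_word_equiv:
  assumes "(v, v') \<in> word_equiv A G" and i: "i \<le> D"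
  shows "card (dist_set G i v) = card (dist_set G i v')"
proof -
  obtain \<sigma> where \<sigma>: "\<sigma> permutes A" "map \<sigma> v = v'" and v: "v \<in> verts G"
    using assms(1) by (auto simp: word_equiv_def)
  have inj: "inj (map \<sigma>)"
    using permutes_inj[OF \<sigma>(1)] by (rule inj_mapI)
  have ws: "walk_set G j v' = map \<sigma> ` walk_set G j v" if "j \<le> i" for j
    using walk_set_map_permutation[OF \<sigma>(1) v, of j] \<sigma>(2) that i by simp
  have "dist_set G i v' = map \<sigma> ` dist_set G i v"
    unfolding dist_set_eq_walk_set_Diff[OF wf_digraph_shift] image_set_diff[OF inj] image_UN
    using ws by auto
  then show ?thesis
    using inj by (simp add: card_image inj_on_def)
qed

section \<open>Input probability and subword criterion\<close>

lemma dist_set_subset: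
  assumes "v \<in> verts G" "1 \<le> i" "i \<le> D"
  shows "dist_set G i v \<subseteq> verts G - {v}"
proof -
  have "walk_set G 0 v \<subseteq> (\<Union>j<i. walk_set G j v)"
    using assms(2) by (intro UN_upper) simp
  moreover have "walk_set G i v \<subseteq> verts G"
    using in_walk_set_iff[OF assms(1,3)] by blast
  ultimately show ?thesis
    unfolding dist_set_eq_walk_set_Diff[OF wf_digraph_shift] walk_set_0[OF assms(1)] by blast
qed

lemma other_vertex:
  assumes "v \<in> verts G"
  shows "verts G - {v} \<noteq> {}"
proof
  assume "verts G - {v} = {}"
  then have "walk_set G 1 v \<subseteq> {v}"
    using in_walk_set_iff[OF assms length_pos] by auto
  then have "card (walk_set G 1 v) \<le> card {v}"
    by (intro card_mono) auto
  then show False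
    using card_walk_set[OF assms length_pos] degree_ge_2 by simp
qed

lemma P_in_eq_sum_over_classes:
  assumes "bij_betw cls {1..l} (verts G // word_equiv A G)"
    and "1 \<le> i" "i \<le> D" and "\<And>r. r \<in> {1..l} \<Longrightarrow> v r \<in> cls r"
  shows "P_in G i =
    (\<Sum>r = 1..l. real (card (dist_set G i (v r))) / (real (card (verts G)) - 1)
                 * (real (card (cls r)) / real (card (verts G))))"
proof -
  let ?n = "real (card (verts G))"
  have "P_in G i = (\<Sum>u\<in>verts G. real (card (dist_set G i u)) / (?n - 1)) / ?n"
    using assms(2,3)
    by (intro P_in_eq_sum finite_verts verts_nonempty other_vertex dist_set_subset)
  also have "(\<Sum>u\<in>verts G. real (card (dist_set G i u)) / (?n - 1)) =
      (\<Sum>r = 1..l. real (card (cls r)) * (real (card (dist_set G i (v r))) / (?n - 1)))"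
    using card_dist_set_word_equiv[OF _ assms(3)]
    by (intro sum_over_quotient[OF finite_verts equiv_word_equiv assms(1) assms(4)]) auto
  also have "\<dots> / ?n = (\<Sum>r = 1..l. real (card (dist_set G i (v r))) / (?n - 1)
                 * (real (card (cls r)) / ?n))"
    unfolding sum_divide_distrib by (intro sum.cong refl) (simp add: mult.commute)
  finally show ?thesis .
qed

text \<open>The first-letter condition attaches to \<open>i\<close> alone: an intermediate \<open>j\<close> is below \<open>i \<le> D\<close>, so
  the inclusion in \<open>walk_set G j v\<close> is decided by subwords.\<close>

lemma max_walk_set_nonempty_iff_subword:
  assumes v: "v \<in> verts G" and ki: "k < i" "i \<le> D"
  shows "max_walk_set G k i v \<noteq> {} \<longleftrightarrow>
    (subword v (k + 1) (D - (i - k)) = subword v (i + 1) D \<and> (i = D \<longrightarrow> R (last v) (v ! k))) \<and>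
    (\<forall>j. k < j \<and> j < i \<longrightarrow> subword v (k + 1) (D - (j - k)) \<noteq> subword v (j + 1) D)"
proof -
  have sub: "walk_set G k v \<subseteq> walk_set G j v \<longleftrightarrow>
      subword v (k + 1) (D - (j - k)) = subword v (j + 1) D \<and> (j = D \<longrightarrow> R (last v) (v ! k))"
    if "k < j" "j \<le> D" for j
  proof -
    \<comment> \<open>Both subwords have \<open>D - j\<close> letters.\<close>
    have "D - (j - k) + 1 - (k + 1) = D - j"
      using that by simp
    then have "subword v (k + 1) (D - (j - k)) = take (D - j) (drop k v)"
      by (simp add: subword_def)
    moreover have "subword v (j + 1) D = drop j v"
      using v by (simp add: subword_def in_verts_iff)
    ultimately show ?thesis
      using walk_set_subset_iff[OF v that] by simp
  qed
  have "(walk_set G k v \<subseteq> walk_set G j v) =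
      (subword v (k + 1) (D - (j - k)) = subword v (j + 1) D)" if "k < j" "j < i" for j
    using sub[of j] that ki(2) by simp
  then show ?thesis
    unfolding max_walk_set_nonempty_iff_subset[OF v ki] sub[OF ki] by blast
qed

end

lemma subword_singleton:
  assumes "k < length v"
  shows "subword v (k + 1) (k + 1) = [v ! k]"
  using assms by (simp add: subword_def take_Suc_conv_app_nth hd_drop_conv_nth take_Suc)

section \<open>The De Bruijn and Kautz digraphs\<close>

lemma regular_letter_relation_de_bruijn:
  assumes "finite A" "card A = d" "d \<ge> 2" "D \<ge> 1"
  shows "regular_letter_relation (\<lambda>_ _. True) A d D"
  using assms by unfold_locales auto

lemma regular_letter_relation_kautz:
  assumes "finite A" "card A = d + 1" "d \<ge> 2" "D \<ge> 1"
  shows "regular_letter_relation (\<noteq>) A d D"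
proof
  fix x assume "x \<in> A"
  moreover have "{y \<in> A. x \<noteq> y} = A - {x}" by auto
  ultimately show "card {y \<in> A. x \<noteq> y} = d" using assms by simp
next
  fix \<sigma> x y assume "\<sigma> permutes A"
  then show "(\<sigma> x \<noteq> \<sigma> y) = (x \<noteq> y)"
    using permutes_inj by (metis injD)
qed (use assms in auto)

text \<open>A constant word carries a loop in the De Bruijn digraph only. That the two digraphs differ keeps
  the two cases of the subword criterion apart.\<close>

lemma de_bruijn_neq_kautz:
  assumes "x \<in> A" "D \<ge> 1"
  shows "de_bruijn A D \<noteq> kautz A D"
proof -
  let ?v = "replicate D x"
  have "(?v, tl ?v @ [x]) \<in> arcs (de_bruijn A D)"
    unfolding de_bruijn_def Let_def using assms by simp
  moreover have "(?v, tl ?v @ [x]) \<notin> arcs (kautz A D)"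
  proof
    assume "(?v, tl ?v @ [x]) \<in> arcs (kautz A D)"
    then obtain y where "tl ?v @ [x] = tl ?v @ [y]" "y \<noteq> last ?v"
      unfolding kautz_def Let_def pre_digraph.select_convs by blast
    then show False using assms(2) by simp
  qed
  ultimately show ?thesis by metis
qed



theorem theorem4:
  fixes A :: "'a set" and d D i l :: nat and G :: "'a word_digraph"
    and cls :: "nat \<Rightarrow> 'a list set" and v :: "nat \<Rightarrow> 'a list"
  assumes "d \<ge> 2" and "D \<ge> 1" and "finite A"
    and "(G = de_bruijn A D \<and> card A = d) \<or> (G = kautz A D \<and> card A = d + 1)"
    and "bij_betw cls {1..l} (verts G // word_equiv A G)"
    and "1 \<le> i" and "i \<le> D"
    and "\<And>r. r \<in> {1..l} \<Longrightarrow> v r \<in> cls r"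
  shows "P_in G i =
      (\<Sum>r = 1..l. real (card (dist_set G i (v r))) / (real (card (verts G)) - 1)
                   * (real (card (cls r)) / real (card (verts G))))
    \<and> (\<exists>a :: nat \<Rightarrow> nat \<Rightarrow> nat.
        P_in G i =
          (\<Sum>r = 1..l. real (card (cls r)) / (real (card (verts G)) * (real (card (verts G)) - 1))
                       * (real d ^ i - (\<Sum>k<i. real (a r k) * real d ^ k)))
        \<and> (\<forall>r\<in>{1..l}. \<forall>k<i.
            a r k \<in> {0, 1}
            \<and> (a r k = 1 \<longleftrightarrow> max_walk_set G k i (v r) \<noteq> {})
            \<and> (G = de_bruijn A D \<or> i < D \<longrightarrow>
                (a r k = 1 \<longleftrightarrow>
                  subword (v r) (k + 1) (D - (i - k)) = subword (v r) (i + 1) D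
                  \<and> (\<forall>j. k < j \<and> j < i \<longrightarrow>
                        subword (v r) (k + 1) (D - (j - k)) \<noteq> subword (v r) (j + 1) D)))
            \<and> (G = kautz A D \<and> i = D \<longrightarrow>
                (a r k = 1 \<longleftrightarrow>
                  subword (v r) (k + 1) (k + 1) \<noteq> subword (v r) D D
                  \<and> (\<forall>j. k < j \<and> j < i \<longrightarrow>
                        subword (v r) (k + 1) (D - (j - k)) \<noteq> subword (v r) (j + 1) D)))))"
proof -
  have "card A > 0" using assms(1,4) by (elim disjE conjE) simp_all
  then have "A \<noteq> {}" by (simp add: card_gt_0_iff)
  then obtain x where "x \<in> A" by blast
  have neq: "de_bruijn A D \<noteq> kautz A D"
    using \<open>x \<in> A\<close> assms(2) by (rule de_bruijn_neq_kautz)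
  obtain R where regular: "regular_letter_relation R A d D" and G: "G = shift_digraph R A D"
    and R_de_bruijn: "G = de_bruijn A D \<Longrightarrow> R = (\<lambda>_ _. True)"
    and R_kautz: "G = kautz A D \<Longrightarrow> R = (\<noteq>)"
  proof (cases "G = de_bruijn A D")
    case True
    then have "card A = d" using assms(4) neq by (elim disjE conjE) simp_all
    show thesis
    proof (rule that)
      show "regular_letter_relation (\<lambda>_ _. True) A d D"
        by (rule regular_letter_relation_de_bruijn[OF assms(3) \<open>card A = d\<close> assms(1,2)])
      show "G = shift_digraph (\<lambda>_ _. True) A D"
        unfolding True by (rule de_bruijn_eq_shift_digraph)
      show "(\<lambda>_ _. True) = (\<lambda>_ _. True)" ..
      show "(\<lambda>_ _. True) = (\<noteq>)" if "G = kautz A D"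
        using neq True that by simp
    qed
  next
    case False
    then have "G = kautz A D" "card A = d + 1" using assms(4) by simp_all
    show thesis
    proof (rule that)
      show "regular_letter_relation (\<noteq>) A d D"
        by (rule regular_letter_relation_kautz[OF assms(3) \<open>card A = d + 1\<close> assms(1,2)])
      show "G = shift_digraph (\<noteq>) A D"
        unfolding \<open>G = kautz A D\<close> by (rule kautz_eq_shift_digraph)
      show "(\<noteq>) = (\<lambda>_ _. True)" if "G = de_bruijn A D"
        using False that by (rule notE)
      show "(\<noteq>) = (\<noteq>)" ..
    qed
  qed
  interpret regular_letter_relation R A d D by (rule regular)
  define a :: "nat \<Rightarrow> nat \<Rightarrow> nat" where "a r k = of_bool (max_walk_set G k i (v r) \<noteq> {})" for r k
  have verts: "v r \<in> verts G" if "r \<in> {1..l}" for r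
  proof -
    have "cls r \<in> verts G // word_equiv A G"
      using bij_betwE[OF assms(5)] that by blast
    then show ?thesis
      using assms(8)[OF that] Union_quotient[OF equiv_word_equiv, of G A] by blast
  qed
  have P: "P_in G i = (\<Sum>r = 1..l. real (card (dist_set G i (v r))) / (real (card (verts G)) - 1)
                 * (real (card (cls r)) / real (card (verts G))))"
    by (rule P_in_eq_sum_over_classes[folded G, OF assms(5-8)])
  also have "\<dots> = (\<Sum>r = 1..l. real (card (cls r)) / (real (card (verts G)) * (real (card (verts G)) - 1))
                       * (real d ^ i - (\<Sum>k<i. real (a r k) * real d ^ k)))"
  proof (intro sum.cong refl)
    fix r assume "r \<in> {1..l}"
    then have "real (card (dist_set G i (v r))) = real d ^ i - (\<Sum>k<i. real (a r k) * real d ^ k)"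
      using card_dist_set[of "v r" i] verts assms(7) by (simp add: a_def G)
    then show "real (card (dist_set G i (v r))) / (real (card (verts G)) - 1)
          * (real (card (cls r)) / real (card (verts G))) =
        real (card (cls r)) / (real (card (verts G)) * (real (card (verts G)) - 1))
          * (real d ^ i - (\<Sum>k<i. real (a r k) * real d ^ k))"
      by (simp add: mult.commute)
  qed
  finally have P_poly: "P_in G i = \<dots>" .
  have coeffs: "a r k \<in> {0, 1}
            \<and> (a r k = 1 \<longleftrightarrow> max_walk_set G k i (v r) \<noteq> {})
            \<and> (G = de_bruijn A D \<or> i < D \<longrightarrow>
                (a r k = 1 \<longleftrightarrow>
                  subword (v r) (k + 1) (D - (i - k)) = subword (v r) (i + 1) D
                  \<and> (\<forall>j. k < j \<and> j < i \<longrightarrow>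
                        subword (v r) (k + 1) (D - (j - k)) \<noteq> subword (v r) (j + 1) D)))
            \<and> (G = kautz A D \<and> i = D \<longrightarrow>
                (a r k = 1 \<longleftrightarrow>
                  subword (v r) (k + 1) (k + 1) \<noteq> subword (v r) D D
                  \<and> (\<forall>j. k < j \<and> j < i \<longrightarrow>
                        subword (v r) (k + 1) (D - (j - k)) \<noteq> subword (v r) (j + 1) D)))"
    if r: "r \<in> {1..l}" and k: "k < i" for r k
  proof -
    let ?v = "v r"
    have v: "?v \<in> verts (shift_digraph R A D)" using verts[OF r] G by simp
    have len: "length ?v = D" using v by (simp add: in_verts_iff)
    have iff: "a r k = 1 \<longleftrightarrow> max_walk_set G k i ?v \<noteq> {}" by (simp add: a_def)
    note crit = max_walk_set_nonempty_iff_subword[OF v k assms(7), folded G]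
    have last: "subword ?v D D = [last ?v]"
    proof -
      have "?v \<noteq> []" using len assms(2) by auto
      then show ?thesis
        using subword_singleton[of "D - 1" ?v] len assms(2) by (simp add: last_conv_nth)
    qed
    have kth: "subword ?v (k + 1) (k + 1) = [?v ! k]"
      using subword_singleton[of k ?v] len k assms(7) by simp
    \<comment> \<open>For \<open>i = D\<close> both subwords are empty, and only the condition on first letters is left.\<close>
    have empty: "subword ?v (k + 1) (D - (i - k)) = subword ?v (i + 1) D" if "i = D"
      using that k by (simp add: subword_def)
    have last_letter: "i = D \<longrightarrow> R (last ?v) (?v ! k)" if "G = de_bruijn A D \<or> i < D"
      using R_de_bruijn that by auto
    have first_letter: "R (last ?v) (?v ! k) \<longleftrightarrow> subword ?v (k + 1) (k + 1) \<noteq> subword ?v D D"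
      if "G = kautz A D"
      unfolding R_kautz[OF that] last kth by auto
    show ?thesis
    proof (intro conjI impI)
      show "a r k \<in> {0, 1}" by (simp add: a_def)
      show "a r k = 1 \<longleftrightarrow> max_walk_set G k i ?v \<noteq> {}" by (rule iff)
    next
      assume "G = de_bruijn A D \<or> i < D"
      note last_letter = eqTrueI[OF last_letter[OF this]]
      show "a r k = 1 \<longleftrightarrow> subword ?v (k + 1) (D - (i - k)) = subword ?v (i + 1) D
          \<and> (\<forall>j. k < j \<and> j < i \<longrightarrow> subword ?v (k + 1) (D - (j - k)) \<noteq> subword ?v (j + 1) D)"
        unfolding iff crit last_letter simp_thms ..
    next
      assume "G = kautz A D \<and> i = D"
      then have "G = kautz A D" "i = D" by blast+
      show "a r k = 1 \<longleftrightarrow> subword ?v (k + 1) (k + 1) \<noteq> subword ?v D D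
          \<and> (\<forall>j. k < j \<and> j < i \<longrightarrow> subword ?v (k + 1) (D - (j - k)) \<noteq> subword ?v (j + 1) D)"
        unfolding iff crit first_letter[OF \<open>G = kautz A D\<close>]
          eqTrueI[OF empty[OF \<open>i = D\<close>]] eqTrueI[OF \<open>i = D\<close>] simp_thms ..
    qed
  qed
  show ?thesis
    by (intro conjI[OF P] exI[of _ a] conjI[OF P_poly]) (intro ballI allI impI coeffs)
qed

end
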